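(* Let $\phi\colon\mathbb{N}\to(0,1]$ be a decreasing function, let $\gamma\in(0,\tfrac12)$, let $N\in\mathbb{N}$, and let $\sigma\in\mathcal{L}_{wbal}(\phi,\gamma,N)$. Then, as $n\to\infty$, $$\mathbb{E}(H_{n,\sigma})\le\frac{1}{\log\bigl(\frac{1}{1-\gamma}\bigr)}\cdot\frac{\log\bigl(2\phi(n)^{-1}(1+\phi(n))\bigr)}{\log(1+\phi(n))}\cdot(\log n)\,(1+o(1)).$$
   Context: $\mathbb{N}=\{1,2,3,\dots\}$; $\log$ is the binary logarithm $\log_2$. "Decreasing" is meant in the non-strict sense. Binary trees: $\mathcal{T}$ is the set of full binary trees, i.e. rooted ordered trees in which each node has either exactly two children (a left and a right one) or none. The size $|t|$ of $t\in\mathcal{T}$ is its number of leaves, and $\mathcal{T}_n$ is the set of $t\in\mathcal{T}$ with $|t|=n$. For $|t|\ge 2$, $t_\ell$ and $t_r$ denote the left and right subtrees at the root. The height is $h(t)=0$ if $|t|=1$ and $h(t)=1+\max(h(t_\ell),h(t_r))$ otherwise. Leaf-centric tree sources: $\mathcal{L}$ is the set of all functions $\sigma\colon\mathbb{N}\times\mathbb{N}\to[0,1]$ with $\sum_{i=1}^{k-1}\sigma(i,k-i)=1$ for every integer $k\ge 2$. For $\sigma\in\mathcal{L}$ define $P_\sigma\colon\mathcal{T}\to[0,1]$ by $P_\sigma(t)=1$ if $|t|=1$ and $P_\sigma(t)=\sigma(|t_\ell|,|t_r|)\cdot P_\sigma(t_\ell)\cdot P_\sigma(t_r)$ otherwise.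 For every $n\ge1$, $P_\sigma$ restricted to $\mathcal{T}_n$ is a probability mass function. $H_{n,\sigma}$ denotes the height of a random tree drawn from $\mathcal{T}_n$ according to $P_\sigma$, so $\mathbb{E}(H_{n,\sigma})=\sum_{t\in\mathcal{T}_n}P_\sigma(t)h(t)$. Weakly-balanced sources: $\mathcal{L}_{wbal}(\phi,\gamma,N)$ is the set of all $\sigma\in\mathcal{L}$ such that $\sum_{\gamma n\le k\le(1-\gamma)n}\sigma(k,n-k)\ge\phi(n)$ for every integer $n\ge N$ (the sum is over integers $k$). An inequality $a_n\le b_n(1+o(1))$ means that there is a real sequence $\varepsilon_n\to0$ with $a_n\le b_n(1+\varepsilon_n)$ for all sufficiently large $n$ (with $\sigma,\phi,\gamma,N$ fixed). *)

theory Defs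
  imports Complex_Main "HOL-Library.Tree"
begin

(* A full binary tree carries no labels: internal nodes are Node l () r and the leaves of the
   full binary tree are exactly the Leaf constructors. Hence size1 (the number of Leaf
   constructors, not the number of nodes) is the size |t|, and height Leaf = 0. *)
type_synonym full_tree = "unit tree"

definition full_trees :: "nat \<Rightarrow> full_tree set" where
  "full_trees n = {t. size1 t = n}"

(* Not needed for stating anything, but it shows that sums over full_trees n are genuine. *)
lemma finite_full_trees: "finite (full_trees n)"
proof (induction n rule: less_induct)
  case (less n)
  define A where "A = (\<Union>i<n. full_trees i)"
  have "finite A" using less by (auto simp: A_def)
  moreover have "full_trees n \<subseteq> insert Leaf ((\<lambda>(l, r). Node l () r) ` (A \<times> A))"
  proof
    fix t assume t: "t \<in> full_trees n"
    show "t \<in> insert Leaf ((\<lambda>(l, r). Node l () r) ` (A \<times> A))"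
    proof (cases t)
      case (Node l x r)
      with t have "l \<in> A" "r \<in> A"
        using size1_ge0[of l] size1_ge0[of r]
        by (auto simp: A_def full_trees_def simp del: size1_ge0)
      with Node show ?thesis by auto
    qed simp
  qed
  ultimately show ?case
    by (meson finite_SigmaI finite_imageI finite_insert finite_subset)
qed

(* Sources are functions on pairs of positive integers; values at 0 are irrelevant. *)
definition leaf_centric :: "(nat \<Rightarrow> nat \<Rightarrow> real) set" where
  "leaf_centric = {\<sigma>. (\<forall>i\<ge>1. \<forall>j\<ge>1. \<sigma> i j \<in> {0..1}) \<and>
                       (\<forall>k\<ge>2. (\<Sum>i=1..k-1. \<sigma> i (k - i)) = 1)}"

fun tree_prob :: "(nat \<Rightarrow> nat \<Rightarrow> real) \<Rightarrow> full_tree \<Rightarrow> real" where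
  "tree_prob \<sigma> Leaf = 1"
| "tree_prob \<sigma> (Node l _ r) = \<sigma> (size1 l) (size1 r) * tree_prob \<sigma> l * tree_prob \<sigma> r"

definition expected_height :: "(nat \<Rightarrow> nat \<Rightarrow> real) \<Rightarrow> nat \<Rightarrow> real" where
  "expected_height \<sigma> n = (\<Sum>t\<in>full_trees n. tree_prob \<sigma> t * real (height t))"

(* For 0 < \<gamma> < 1 and n \<ge> 1, the summation range only contains k with 0 < k < n. *)
definition weakly_balanced ::
  "(nat \<Rightarrow> real) \<Rightarrow> real \<Rightarrow> nat \<Rightarrow> (nat \<Rightarrow> nat \<Rightarrow> real) set" where
  "weakly_balanced \<phi> \<gamma> N = {\<sigma> \<in> leaf_centric.
     \<forall>n\<ge>N. (\<Sum>k | \<gamma> * real n \<le> real k \<and> real k \<le> (1 - \<gamma>) * real n. \<sigma> k (n - k)) \<ge> \<phi> n}"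

end

(* For x > 1 the exponential moment F m = E (x ^ H_m) satisfies
   F m <= x * (sum over i of \<sigma> i (m - i) * (F i + F (m - i))). If F i <= C * i powr \<alpha> for
   smaller i, an arbitrary split contributes at most C * m powr \<alpha> (since \<alpha> >= 1), whereas a
   \<gamma>-balanced one contributes at most 2 * (1 - \<gamma>) powr \<alpha> times as much. For x = 1 + p and
   2 * (1 - \<gamma>) powr \<alpha> = p / (1 + p), balanced splits of probability at least p = \<phi> n make
   the bound reproduce itself exactly for all m <= n, and Jensen's inequality turns it into
   E H_n <= (ln C + \<alpha> * ln n) / ln (1 + p), which is the claim because ln C / ln (1 + p) is
   bounded. *)

theory Submission
  imports Defs
begin

section \<open>Root decomposition and total probability\<close>

lemma full_trees_Suc_0: "full_trees (Suc 0) = {Leaf}"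
proof -
  have "size1 t = Suc 0 \<longleftrightarrow> t = Leaf" for t :: full_tree
    by (cases t) (auto simp: size1_size)
  thus ?thesis by (auto simp: full_trees_def)
qed

text \<open>Cutting a tree at its root gives a bijection with pairs of subtrees; grouping the pairs
  by the left size \<open>i\<close> matches the way \<sigma> enters
  \<open>tree_prob\<close>.\<close>

lemma sum_full_trees_rec:
  fixes f :: "full_tree \<Rightarrow> 'a :: comm_monoid_add"
  assumes "m \<ge> 2"
  shows "(\<Sum>t\<in>full_trees m. f t) =
         (\<Sum>i=1..m-1. \<Sum>l\<in>full_trees i. \<Sum>r\<in>full_trees (m - i). f (Node l () r))"
proof -
  let ?A = "SIGMA i:{1..m-1}. full_trees i \<times> full_trees (m - i)"
  let ?h = "\<lambda>(i::nat, l, r). Node l () r :: full_tree"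
  have "inj_on ?h ?A"
    by (auto simp: inj_on_def full_trees_def)
  moreover have "?h ` ?A = full_trees m"
  proof (intro equalityI subsetI)
    fix t assume t: "t \<in> full_trees m"
    with assms obtain l r where lr: "t = Node l () r"
      by (cases t) (auto simp: full_trees_def)
    have "(size1 l, l, r) \<in> ?A"
      using t size1_ge0[of l] size1_ge0[of r] unfolding lr full_trees_def
      by (auto simp del: size1_ge0)
    thus "t \<in> ?h ` ?A" using lr by force
  qed (use assms in \<open>auto simp: full_trees_def\<close>)
  ultimately have "(\<Sum>t\<in>full_trees m. f t) = (\<Sum>x\<in>?A. f (?h x))"
    using sum.reindex[of ?h ?A f] by (simp add: o_def)
  also have "\<dots> = (\<Sum>i=1..m-1. \<Sum>(l, r)\<in>full_trees i \<times> full_trees (m - i). f (Node l () r))"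
    by (subst sum.Sigma) (auto simp: finite_full_trees intro!: sum.cong)
  finally show ?thesis
    by (simp add: sum.cartesian_product)
qed

lemma tree_prob_nonneg:
  assumes "\<sigma> \<in> leaf_centric"
  shows "tree_prob \<sigma> t \<ge> 0"
proof (induction t)
  case (Node l x r)
  have "size1 l \<ge> 1" "size1 r \<ge> 1" by (simp_all add: Suc_leI)
  with assms have "\<sigma> (size1 l) (size1 r) \<ge> 0" by (auto simp: leaf_centric_def)
  with Node show ?case by simp
qed simp

text \<open>The root factor depends only on the two subtree sizes, so it is constant on the inner
  sums. What remains is a product: given their sizes, the subtrees are independent.\<close>

lemma sum_tree_prob_Node:
  fixes f :: "full_tree \<Rightarrow> full_tree \<Rightarrow> real"
  shows "(\<Sum>l\<in>full_trees i. \<Sum>r\<in>full_trees j. tree_prob \<sigma> (Node l () r) * f l r) =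
    \<sigma> i j * (\<Sum>l\<in>full_trees i. \<Sum>r\<in>full_trees j. tree_prob \<sigma> l * tree_prob \<sigma> r * f l r)"
  unfolding sum_distrib_left by (intro sum.cong refl) (simp add: full_trees_def)

lemma sum_tree_prob_eq_1:
  assumes "\<sigma> \<in> leaf_centric" "m \<ge> 1"
  shows "(\<Sum>t\<in>full_trees m. tree_prob \<sigma> t) = 1"
  using assms(2)
proof (induction m rule: less_induct)
  case (less m)
  show ?case
  proof (cases "m = 1")
    case True
    thus ?thesis by (simp add: full_trees_Suc_0)
  next
    case False
    hence m: "m \<ge> 2" using less.prems by simp
    have "(\<Sum>t\<in>full_trees m. tree_prob \<sigma> t) =
          (\<Sum>i=1..m-1. \<sigma> i (m - i) *
             (\<Sum>l\<in>full_trees i. \<Sum>r\<in>full_trees (m - i). tree_prob \<sigma> l * tree_prob \<sigma> r))"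
      unfolding sum_full_trees_rec[OF m]
      using sum_tree_prob_Node[where f = "\<lambda>_ _. 1"] by simp
    also have "\<dots> = (\<Sum>i=1..m-1. \<sigma> i (m - i))"
      by (intro sum.cong refl) (auto simp: less.IH simp flip: sum_product)
    also have "\<dots> = 1" using assms(1) m by (auto simp: leaf_centric_def)
    finally show ?thesis .
  qed
qed

section \<open>Exponential moments of the height\<close>

definition height_moment :: "(nat \<Rightarrow> nat \<Rightarrow> real) \<Rightarrow> real \<Rightarrow> nat \<Rightarrow> real" where
  "height_moment \<sigma> x m = (\<Sum>t\<in>full_trees m. tree_prob \<sigma> t * x ^ height t)"

text \<open>Crude bound, uniform in all sizes up to \<open>N\<close>; it starts the induction in
  \<open>height_moment_le_powr\<close>.\<close>

lemma height_moment_le_power: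
  assumes "\<sigma> \<in> leaf_centric" "x \<ge> 1" "m \<ge> 1" "m \<le> N"
  shows "height_moment \<sigma> x m \<le> x ^ N"
proof -
  have "height_moment \<sigma> x m \<le> (\<Sum>t\<in>full_trees m. tree_prob \<sigma> t * x ^ N)"
    unfolding height_moment_def
  proof (intro sum_mono mult_left_mono power_increasing)
    fix t assume "t \<in> full_trees m"
    \<comment> \<open>A full binary tree with \<open>m\<close> leaves has \<open>m - 1\<close>
      internal nodes, and its height is at most their number.\<close>
    hence "height t < m"
      using height_le_size_tree[of t] by (simp add: full_trees_def size1_size)
    thus "height t \<le> N" using assms by simp
  qed (use assms tree_prob_nonneg in auto)
  also have "\<dots> = x ^ N"
    using sum_tree_prob_eq_1[OF assms(1,3)] by (simp flip: sum_distrib_right)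
  finally show ?thesis .
qed

text \<open>The power of a maximum is at most the sum of the two powers. By independence, each of
  these is averaged over its own subtree only, while the other subtree contributes total probability
  1.\<close>

lemma height_moment_rec_le:
  assumes \<sigma>: "\<sigma> \<in> leaf_centric" and "x \<ge> 1" and m: "m \<ge> 2"
  shows "height_moment \<sigma> x m \<le>
         x * (\<Sum>i=1..m-1. \<sigma> i (m - i) * (height_moment \<sigma> x i + height_moment \<sigma> x (m - i)))"
proof -
  have "height_moment \<sigma> x m = (\<Sum>i=1..m-1. \<sigma> i (m - i) *
          (\<Sum>l\<in>full_trees i. \<Sum>r\<in>full_trees (m - i). tree_prob \<sigma> l * tree_prob \<sigma> r *
             x ^ Suc (max (height l) (height r))))"
    unfolding height_moment_def sum_full_trees_rec[OF m]
    using sum_tree_prob_Node[where f = "\<lambda>l r. x ^ Suc (max (height l) (height r))"] by simp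
  also have "\<dots> \<le> (\<Sum>i=1..m-1. \<sigma> i (m - i) *
                 (x * (height_moment \<sigma> x i + height_moment \<sigma> x (m - i))))"
  proof (intro sum_mono mult_left_mono)
    fix i assume i: "i \<in> {1..m-1}"
    have "x ^ max a b \<le> x ^ a + x ^ b" for a b :: nat
      using \<open>x \<ge> 1\<close> by (cases "a \<le> b") (auto simp: max_def)
    hence "(\<Sum>l\<in>full_trees i. \<Sum>r\<in>full_trees (m - i). tree_prob \<sigma> l * tree_prob \<sigma> r *
             x ^ Suc (max (height l) (height r))) \<le>
           (\<Sum>l\<in>full_trees i. \<Sum>r\<in>full_trees (m - i). tree_prob \<sigma> l * tree_prob \<sigma> r *
             (x * (x ^ height l + x ^ height r)))"
      using \<open>x \<ge> 1\<close> tree_prob_nonneg[OF \<sigma>] by (intro sum_mono mult_left_mono) auto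
    also have "\<dots> = x * ((\<Sum>l\<in>full_trees i. tree_prob \<sigma> l * x ^ height l) *
                            (\<Sum>r\<in>full_trees (m - i). tree_prob \<sigma> r) +
                          (\<Sum>l\<in>full_trees i. tree_prob \<sigma> l) *
                            (\<Sum>r\<in>full_trees (m - i). tree_prob \<sigma> r * x ^ height r))"
      unfolding sum_product unfolding sum_distrib_left sum.distrib[symmetric]
      by (intro sum.cong refl) (simp add: algebra_simps)
    also have "\<dots> = x * (height_moment \<sigma> x i + height_moment \<sigma> x (m - i))"
      using i m by (subst (1 2) sum_tree_prob_eq_1[OF \<sigma>]) (auto simp: height_moment_def)
    finally show "(\<Sum>l\<in>full_trees i. \<Sum>r\<in>full_trees (m - i). tree_prob \<sigma> l * tree_prob \<sigma> r *
             x ^ Suc (max (height l) (height r)))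
        \<le> x * (height_moment \<sigma> x i + height_moment \<sigma> x (m - i))" .
    show "0 \<le> \<sigma> i (m - i)" using \<sigma> i m by (auto simp: leaf_centric_def)
  qed
  finally show ?thesis by (simp add: sum_distrib_left algebra_simps)
qed

section \<open>Power bounds from balanced splits\<close>

lemma powr_add_le_split:
  fixes i j \<alpha> :: real
  assumes "0 < i" "0 < j" "\<alpha> \<ge> 1"
  shows "i powr \<alpha> + j powr \<alpha> \<le> (i + j) powr \<alpha>"
proof -
  \<comment> \<open>Splitting off one factor leaves the nonnegative exponent \<alpha> - 1, so the
    remaining powers can be bounded monotonically by the one at \<open>i + j\<close>.\<close>
  have split: "y powr \<alpha> = y * y powr (\<alpha> - 1)" if "y > 0" for y :: real
    using that by (simp add: powr_diff)
  have "i powr (\<alpha> - 1) \<le> (i + j) powr (\<alpha> - 1)" "j powr (\<alpha> - 1) \<le> (i + j) powr (\<alpha> - 1)"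
    using assms by (auto intro!: powr_mono2)
  hence "i * i powr (\<alpha> - 1) + j * j powr (\<alpha> - 1) \<le> (i + j) * (i + j) powr (\<alpha> - 1)"
    using assms by (simp add: distrib_right add_mono)
  thus ?thesis using assms by (simp add: split)
qed

text \<open>A balanced split gains the factor \<delta>, any other split only the factor 1 from
  superadditivity. Averaging saves 1 - \<delta> on mass at least \<open>p\<close>, and \<delta>
  \<le> 1 makes the bound monotone in that mass.\<close>

lemma balanced_sum_powr_le:
  assumes \<sigma>: "\<sigma> \<in> leaf_centric" and \<gamma>: "0 < \<gamma>" and m: "m \<ge> 2" and \<alpha>: "\<alpha> \<ge> 1"
    and \<delta>: "2 * (1 - \<gamma>) powr \<alpha> = \<delta>" "\<delta> \<le> 1"
    and p: "p \<le> (\<Sum>k | \<gamma> * real m \<le> real k \<and> real k \<le> (1 - \<gamma>) * real m. \<sigma> k (m - k))"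
  shows "(\<Sum>i=1..m-1. \<sigma> i (m - i) * (real i powr \<alpha> + real (m - i) powr \<alpha>))
           \<le> (1 - p * (1 - \<delta>)) * real m powr \<alpha>"
proof -
  define B where "B = {k. \<gamma> * real m \<le> real k \<and> real k \<le> (1 - \<gamma>) * real m}"
  have B: "B \<subseteq> {1..m-1}"
  proof
    fix k assume k: "k \<in> B"
    have "0 < \<gamma> * real m" using \<gamma> m by simp
    hence "0 < real k" "real k < real m" using k by (auto simp: B_def algebra_simps)
    thus "k \<in> {1..m-1}" by auto
  qed
  have "(\<Sum>i=1..m-1. \<sigma> i (m - i) * (real i powr \<alpha> + real (m - i) powr \<alpha>))
      \<le> (\<Sum>i=1..m-1. \<sigma> i (m - i) * ((1 - (if i \<in> B then 1 - \<delta> else 0)) * real m powr \<alpha>))"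
  proof (intro sum_mono mult_left_mono)
    fix i assume i: "i \<in> {1..m-1}"
    show "0 \<le> \<sigma> i (m - i)" using \<sigma> i m by (auto simp: leaf_centric_def)
    show "real i powr \<alpha> + real (m - i) powr \<alpha>
            \<le> (1 - (if i \<in> B then 1 - \<delta> else 0)) * real m powr \<alpha>"
    proof (cases "i \<in> B")
      case True
      \<comment> \<open>The balanced range is symmetric: the lower bound on \<open>i\<close> is the
        upper bound on \<open>m - i\<close>.\<close>
      hence "real i \<le> (1 - \<gamma>) * real m" "real (m - i) \<le> (1 - \<gamma>) * real m"
        using i m by (auto simp: B_def algebra_simps of_nat_diff)
      \<comment> \<open>Existence of a balanced \<open>i\<close> forces 1 - \<gamma> \<ge> 0, under
        which the power of the product splits.\<close>
      moreover from this have "0 \<le> (1 - \<gamma>) * real m" by linarith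
      hence "0 \<le> 1 - \<gamma>" using m by (simp add: zero_le_mult_iff)
      ultimately have "real i powr \<alpha> \<le> (1 - \<gamma>) powr \<alpha> * real m powr \<alpha>"
          "real (m - i) powr \<alpha> \<le> (1 - \<gamma>) powr \<alpha> * real m powr \<alpha>"
        using \<alpha> by (auto simp flip: powr_mult intro!: powr_mono2)
      thus ?thesis using True by (simp flip: \<delta>(1))
    next
      case False
      thus ?thesis
        using powr_add_le_split[of "real i" "real (m - i)" \<alpha>] i m \<alpha> by (auto simp flip: of_nat_add)
    qed
  qed
  also have "\<dots> = ((\<Sum>i=1..m-1. \<sigma> i (m - i)) -
                     (\<Sum>i=1..m-1. if i \<in> B then \<sigma> i (m - i) else 0) * (1 - \<delta>)) * real m powr \<alpha>"
    unfolding sum_distrib_right sum_subtractf[symmetric]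
    by (intro sum.cong refl) (simp add: algebra_simps)
  also have "(\<Sum>i=1..m-1. if i \<in> B then \<sigma> i (m - i) else 0) = (\<Sum>i\<in>B. \<sigma> i (m - i))"
    using B by (simp add: sum.If_cases Int_absorb1 flip: sum.inter_restrict)
  also have "(\<Sum>i=1..m-1. \<sigma> i (m - i)) = 1"
    using \<sigma> m by (auto simp: leaf_centric_def)
  also have "(1 - (\<Sum>i\<in>B. \<sigma> i (m - i)) * (1 - \<delta>)) * real m powr \<alpha>
      \<le> (1 - p * (1 - \<delta>)) * real m powr \<alpha>"
    using p \<delta>(2) by (auto intro!: mult_right_mono simp: B_def)
  finally show ?thesis .
qed

text \<open>One \<open>p\<close> serves all sizes up to a fixed \<open>n\<close>. The induction only
  descends to smaller sizes, so balance is required between \<open>N\<close> and \<open>n\<close>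
  only; the constant \<open>(1 + p) ^ Suc N\<close> covers the initial sizes.\<close>

lemma height_moment_le_powr:
  assumes \<sigma>: "\<sigma> \<in> leaf_centric" and \<gamma>: "0 < \<gamma>" and \<alpha>: "\<alpha> \<ge> 1"
    and p: "0 < p"
    and \<alpha>_eq: "2 * (1 - \<gamma>) powr \<alpha> = p / (1 + p)"
    and bal: "\<And>m. N \<le> m \<Longrightarrow> m \<le> n \<Longrightarrow>
      p \<le> (\<Sum>k | \<gamma> * real m \<le> real k \<and> real k \<le> (1 - \<gamma>) * real m. \<sigma> k (m - k))"
    and "1 \<le> m" "m \<le> n"
  shows "height_moment \<sigma> (1 + p) m \<le> (1 + p) ^ Suc N * real m powr \<alpha>"
  using assms(7,8)
proof (induction m rule: less_induct)
  case (less m)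
  show ?case
  \<comment> \<open>Cutting at \<open>Suc N\<close> leaves only sizes at least 2, even for
    \<open>N = 0\<close>, so the root decomposition applies.\<close>
  proof (cases "m \<le> Suc N")
    case True
    have "height_moment \<sigma> (1 + p) m \<le> (1 + p) ^ Suc N"
      using height_moment_le_power[OF \<sigma> _ _ True, of "1 + p"] less.prems p by simp
    also have "\<dots> \<le> (1 + p) ^ Suc N * real m powr \<alpha>"
      using less.prems p \<alpha> mult_left_mono[of 1 "real m powr \<alpha>" "(1 + p) ^ Suc N"]
      by (simp add: ge_one_powr_ge_zero)
    finally show ?thesis .
  next
    case False
    hence m: "m \<ge> 2" by simp
    let ?C = "(1 + p) ^ Suc N"
    have "height_moment \<sigma> (1 + p) m \<le> (1 + p) *
        (\<Sum>i=1..m-1. \<sigma> i (m - i) * (height_moment \<sigma> (1 + p) i + height_moment \<sigma> (1 + p) (m - i)))"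
      using \<sigma> p m by (intro height_moment_rec_le) auto
    also have "\<dots> \<le> (1 + p) * (\<Sum>i=1..m-1. \<sigma> i (m - i) *
        (?C * real i powr \<alpha> + ?C * real (m - i) powr \<alpha>))"
    proof (intro mult_left_mono sum_mono add_mono)
      fix i assume i: "i \<in> {1..m-1}"
      show "height_moment \<sigma> (1 + p) i \<le> ?C * real i powr \<alpha>"
        using i m less.prems by (intro less.IH) auto
      show "height_moment \<sigma> (1 + p) (m - i) \<le> ?C * real (m - i) powr \<alpha>"
        using i m less.prems by (intro less.IH) auto
      show "0 \<le> \<sigma> i (m - i)" using \<sigma> i m by (auto simp: leaf_centric_def)
    qed (use p in simp)
    also have "\<dots> = (1 + p) * ?C *
        (\<Sum>i=1..m-1. \<sigma> i (m - i) * (real i powr \<alpha> + real (m - i) powr \<alpha>))"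
      by (simp add: sum_distrib_left algebra_simps)
    also have "\<dots> \<le> (1 + p) * ?C * ((1 - p * (1 - p / (1 + p))) * real m powr \<alpha>)"
      using False less.prems p
      by (intro mult_left_mono balanced_sum_powr_le[OF \<sigma> \<gamma> m \<alpha> \<alpha>_eq _ bal]) auto
    also have "\<dots> = ?C * real m powr \<alpha> * ((1 + p) * (1 - p * (1 - p / (1 + p))))"
      by (simp only: ac_simps)
    \<comment> \<open>Since 1 - p / (1 + p) = 1 / (1 + p), the saving from balanced splits exactly
      cancels the factor 1 + p paid for one level of height.\<close>
    also have "(1 + p) * (1 - p * (1 - p / (1 + p))) = 1"
      using p by (simp add: field_simps)
    finally show ?thesis by simp
  qed
qed

section \<open>From moments to the expected height\<close>

lemma expected_height_le_ln_moment:
  assumes \<sigma>: "\<sigma> \<in> leaf_centric" and x: "x > 1" and "n \<ge> 1"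
    and M: "height_moment \<sigma> x n \<le> M" "M > 0"
  shows "expected_height \<sigma> n * ln x \<le> ln M"
proof -
  \<comment> \<open>Jensen's inequality in elementary form: ln y \<le> y - 1 at
    \<open>y = x ^ h / M\<close>, to be averaged over all trees.\<close>
  have tangent: "1 + real h * ln x - ln M \<le> x ^ h / M" for h
    using ln_le_minus_one[of "x ^ h / M"] x M by (simp add: ln_div ln_realpow)
  have "1 + expected_height \<sigma> n * ln x - ln M =
        (\<Sum>t\<in>full_trees n. tree_prob \<sigma> t) * (1 - ln M) + expected_height \<sigma> n * ln x"
    using sum_tree_prob_eq_1[OF \<sigma> \<open>n \<ge> 1\<close>] by simp
  also have "\<dots> = (\<Sum>t\<in>full_trees n. tree_prob \<sigma> t * (1 + real (height t) * ln x - ln M))"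
    unfolding expected_height_def sum_distrib_right sum.distrib[symmetric]
    by (intro sum.cong refl) (simp add: algebra_simps)
  also have "\<dots> \<le> (\<Sum>t\<in>full_trees n. tree_prob \<sigma> t * (x ^ height t / M))"
    using tangent tree_prob_nonneg[OF \<sigma>] by (intro sum_mono mult_left_mono) auto
  also have "\<dots> = height_moment \<sigma> x n / M"
    by (simp add: height_moment_def sum_divide_distrib)
  also have "\<dots> \<le> 1" using M by simp
  finally show ?thesis by simp
qed

lemma expected_height_le:
  assumes \<sigma>: "\<sigma> \<in> leaf_centric" and \<gamma>: "0 < \<gamma>" "\<gamma> < 1 / 2" and p: "0 < p" "p \<le> 1"
    and bal: "\<And>m. N \<le> m \<Longrightarrow> m \<le> n \<Longrightarrow>
      p \<le> (\<Sum>k | \<gamma> * real m \<le> real k \<and> real k \<le> (1 - \<gamma>) * real m. \<sigma> k (m - k))"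
    and n: "n \<ge> 1"
  shows "expected_height \<sigma> n \<le>
    real (Suc N) + ln (2 * inverse p * (1 + p)) / ln (1 / (1 - \<gamma>)) * ln (real n) / ln (1 + p)"
proof -
  define D where "D = ln (1 / (1 - \<gamma>))"
  define b where "b = ln (2 * inverse p * (1 + p))"
  \<comment> \<open>The logarithm of 2 (1 + p) / p to base 1 / (1 - \<gamma>), that is, the solution
    of \<open>2 * (1 - \<gamma>) powr \<alpha> = p / (1 + p)\<close>.\<close>
  define \<alpha> where "\<alpha> = b / D"
  have D: "D > 0" using \<gamma> by (simp add: D_def)
  \<comment> \<open>Comparing both logarithms through 2 yields \<alpha> \<ge> 1, the range in which
    powers are superadditive.\<close>
  have "1 / (1 - \<gamma>) \<le> 2" using \<gamma> by (simp add: divide_simps)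
  also have "2 \<le> 2 * inverse p * (1 + p)" using p by (simp add: field_simps)
  finally have "D \<le> b" unfolding D_def b_def using \<gamma> p by simp
  hence \<alpha>: "\<alpha> \<ge> 1" using D by (simp add: \<alpha>_def)
  have "\<alpha> * ln (1 - \<gamma>) = - b"
    using D \<gamma> by (simp add: \<alpha>_def D_def ln_div)
  hence "(1 - \<gamma>) powr \<alpha> = exp (- b)" using \<gamma> by (simp add: powr_def)
  also have "\<dots> = p / (2 * (1 + p))"
    using p by (simp add: b_def exp_minus field_simps)
  finally have "2 * (1 - \<gamma>) powr \<alpha> = p / (1 + p)" using p by (simp add: field_simps)
  from height_moment_le_powr[OF \<sigma> \<gamma>(1) \<alpha> p(1) this bal n order_refl]
  have "height_moment \<sigma> (1 + p) n \<le> (1 + p) ^ Suc N * real n powr \<alpha>" .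
  with \<sigma> p n have "expected_height \<sigma> n * ln (1 + p) \<le> ln ((1 + p) ^ Suc N * real n powr \<alpha>)"
    by (intro expected_height_le_ln_moment) auto
  also have "\<dots> = real (Suc N) * ln (1 + p) + \<alpha> * ln (real n)"
    using p n by (subst ln_mult) (auto simp: ln_realpow ln_powr simp del: power_Suc)
  finally have "expected_height \<sigma> n \<le> (real (Suc N) * ln (1 + p) + \<alpha> * ln (real n)) / ln (1 + p)"
    using p by (simp add: pos_le_divide_eq)
  also have "\<dots> = real (Suc N) + \<alpha> * ln (real n) / ln (1 + p)"
    using p by (simp add: add_divide_distrib)
  finally show ?thesis by (simp add: \<alpha>_def b_def D_def)
qed

section \<open>Absorbing the additive constant into the error term\<close>

theorem theorem3p8:
  fixes \<phi> :: "nat \<Rightarrow> real" and \<gamma> :: real and N :: nat and \<sigma> :: "nat \<Rightarrow> nat \<Rightarrow> real"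
  assumes "\<And>n. n \<ge> 1 \<Longrightarrow> \<phi> n \<in> {0<..1}"
    and "\<And>m n. 1 \<le> m \<Longrightarrow> m \<le> n \<Longrightarrow> \<phi> n \<le> \<phi> m"
    and "\<gamma> \<in> {0<..<1/2}"
    and "N \<ge> 1"
    and "\<sigma> \<in> weakly_balanced \<phi> \<gamma> N"
  shows "\<exists>\<epsilon> :: nat \<Rightarrow> real. \<epsilon> \<longlonglongrightarrow> 0 \<and>
    (\<forall>\<^sub>F n in sequentially.
       expected_height \<sigma> n
         \<le> 1 / log 2 (1 / (1 - \<gamma>))
           * (log 2 (2 * inverse (\<phi> n) * (1 + \<phi> n)) / log 2 (1 + \<phi> n))
           * log 2 (real n) * (1 + \<epsilon> n))"
proof -
  define D where "D = ln (1 / (1 - \<gamma>))"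
  \<comment> \<open>Chosen to absorb the additive \<open>Suc N\<close>: the main term is at least ln
    n / D, because its other factor \<open>b / ln (1 + p)\<close> is at least 1.\<close>
  define \<epsilon> where "\<epsilon> n = real (Suc N) * D / ln (real n)" for n :: nat
  have D: "D > 0" using assms(3) by (simp add: D_def)
  have "filterlim (\<lambda>n. ln (real n)) at_top sequentially"
    by (rule filterlim_compose[OF ln_at_top filterlim_real_sequentially])
  hence "\<epsilon> \<longlonglongrightarrow> 0"
    unfolding \<epsilon>_def by (rule real_tendsto_divide_at_top[OF tendsto_const])
  moreover have "expected_height \<sigma> n
         \<le> 1 / log 2 (1 / (1 - \<gamma>))
           * (log 2 (2 * inverse (\<phi> n) * (1 + \<phi> n)) / log 2 (1 + \<phi> n))
           * log 2 (real n) * (1 + \<epsilon> n)" if n: "n \<ge> 2" for n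
  proof -
    define p where "p = \<phi> n"
    define b where "b = ln (2 * inverse p * (1 + p))"
    define A where "A = b / D * ln (real n) / ln (1 + p)"
    have p: "0 < p" "p \<le> 1" using assms(1)[of n] n by (auto simp: p_def)
    \<comment> \<open>As \<phi> is decreasing, its value at \<open>n\<close> is a common lower bound
      for all \<open>m\<close> up to \<open>n\<close>.\<close>
    have bal: "p \<le> (\<Sum>k | \<gamma> * real m \<le> real k \<and> real k \<le> (1 - \<gamma>) * real m. \<sigma> k (m - k))"
      if "N \<le> m" "m \<le> n" for m
      using assms(2)[of m n] assms(4,5) that unfolding p_def weakly_balanced_def
      by (auto intro: order_trans)
    have "expected_height \<sigma> n \<le> real (Suc N) + A"
      unfolding A_def b_def D_def
      using assms(3,5) n p bal by (intro expected_height_le) (auto simp: weakly_balanced_def)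
    also have "real (Suc N) \<le> A * \<epsilon> n"
    proof -
      have "1 + p \<le> 2 * inverse p * (1 + p)"
        using p by (simp add: field_simps) (smt (verit) mult_left_le)
      hence "ln (1 + p) \<le> b"
        unfolding b_def using p by simp
      hence "1 \<le> b / ln (1 + p)" using p by (simp add: pos_le_divide_eq)
      hence "real (Suc N) * 1 \<le> real (Suc N) * (b / ln (1 + p))"
        by (intro mult_left_mono) auto
      \<comment> \<open>The cancellation needs ln n > 0, hence n \<ge> 2; at n = 1, division by zero
        would make the error term 0.\<close>
      also have "\<dots> = A * \<epsilon> n"
        using D n p by (simp add: A_def \<epsilon>_def)
      finally show ?thesis by simp
    qed
    finally have "expected_height \<sigma> n \<le> A * (1 + \<epsilon> n)" by (simp add: algebra_simps)
    also have "A = 1 / log 2 (1 / (1 - \<gamma>)) *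
        (log 2 (2 * inverse p * (1 + p)) / log 2 (1 + p)) * log 2 (real n)"
      by (simp add: log_def A_def b_def D_def)
    finally show ?thesis by (simp only: p_def)
  qed
  ultimately show ?thesis
    by (intro exI[of _ \<epsilon>] conjI eventually_sequentiallyI[of 2])
qed

end
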